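(* There exist matrices $A,B\in M_3(\mathbb{R})$ with $\det(A)=\det(B)$ and $D_\phi(A)\ne D_\phi(B)$.
   Context: Let $n=3$, $\omega=e^{2\pi i/3}$, let $S_3$ be the symmetric group on $\{1,2,3\}$ with composition $(\sigma\circ\tau)(i)=\sigma(\tau(i))$, let $\varepsilon(\sigma)$ be the sign of $\sigma$, and let $\rho=(1\,2\,3)$, i.e. $\rho(1)=2,\rho(2)=3,\rho(3)=1$. Each orbit $\{\sigma\circ\rho^r:r\in\mathbb{Z}/3\mathbb{Z}\}$ contains exactly one $\sigma^*$ with $\sigma^*(1)=1$. The orbital phase $\phi:S_3\to\mathbb{Z}/3\mathbb{Z}$ is the unique function such that $\phi(\sigma^*\circ\rho^r)=r$ for every $\sigma^*\in S_3$ with $\sigma^*(1)=1$ and every $r$. For $A=(a_{ij})\in M_3(\mathbb{C})$ put $m_\sigma(A)=\varepsilon(\sigma)\prod_{i=1}^3 a_{i,\sigma(i)}$, $\Lambda_r(A)=\sum_{\sigma:\phi(\sigma)=r}m_\sigma(A)$ for $r=0,1,2$, $G_k(A)=\sum_{r=0}^{2}\Lambda_r(A)\omega^{kr}$ for $k=0,1,2$, and $D_\phi(A)=(G_0(A),G_1(A),G_2(A))\in\mathbb{C}^3$. *)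

theory Defs
  imports "HOL-Analysis.Analysis" "HOL-Combinatorics.Permutations"
begin

text \<open>
  The index set \<open>{1, 2, 3}\<close> is the numeral type \<open>3\<close>, and an element of the symmetric group is a
  function \<open>\<sigma> :: 3 \<Rightarrow> 3\<close> with \<open>\<sigma> permutes UNIV\<close>. Elements of \<open>\<int>/3\<int>\<close> are represented by
  the natural numbers \<open>0, 1, 2\<close>.
\<close>

definition omega :: complex where
  "omega = exp (2 * of_real pi * \<i> / 3)"

definition rho :: "3 \<Rightarrow> 3" where
  "rho i = (if i = 1 then 2 else if i = 2 then 3 else 1)"

text \<open>Only the values at permutations are meaningful; these are pinned down by
  \<open>orbital_phase_eq\<close> and \<open>orbital_phase_unique\<close> below.\<close>

definition orbital_phase :: "(3 \<Rightarrow> 3) \<Rightarrow> nat" where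
  "orbital_phase \<sigma> =
     (THE r. r < 3 \<and> (\<exists>\<tau>. \<tau> permutes UNIV \<and> \<tau> 1 = 1 \<and> \<sigma> = \<tau> \<circ> (rho ^^ r)))"

definition signed_monomial :: "(3 \<Rightarrow> 3) \<Rightarrow> complex^3^3 \<Rightarrow> complex" where
  "signed_monomial \<sigma> A = of_int (sign \<sigma>) * (\<Prod>i\<in>UNIV. A $ i $ \<sigma> i)"

definition Lambda :: "nat \<Rightarrow> complex^3^3 \<Rightarrow> complex" where
  "Lambda r A =
     (\<Sum>\<sigma> | \<sigma> permutes UNIV \<and> orbital_phase \<sigma> = r. signed_monomial \<sigma> A)"

definition G :: "nat \<Rightarrow> complex^3^3 \<Rightarrow> complex" where
  "G k A = (\<Sum>r = 0..2. Lambda r A * omega ^ (k * r))"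

definition D_phi :: "complex^3^3 \<Rightarrow> complex^3" where
  "D_phi A = vector [G 0 A, G 1 A, G 2 A]"

lemma distinct_3: "(1::3) \<noteq> 2" "(1::3) \<noteq> 3" "(2::3) \<noteq> 3"
  by simp_all

lemma rho_simps [simp]: "rho 1 = 2" "rho 2 = 3" "rho 3 = 1"
  using distinct_3 by (simp_all add: rho_def del: one_neq_zero)

lemma rho_permutes: "rho permutes UNIV"
proof (rule bij_imp_permutes)
  have "inj rho"
    using distinct_3 by (intro injI) (metis exhaust_3 rho_simps)
  then show "bij_betw rho UNIV UNIV"
    by (simp add: finite_UNIV_inj_surj bij_def)
qed simp

lemma rho_pow_permutes: "(rho ^^ n) permutes UNIV"
proof (induction n)
  case 0
  show ?case unfolding funpow.simps by (rule permutes_id)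
next
  case (Suc n)
  show ?case unfolding funpow.simps by (rule permutes_compose[OF Suc rho_permutes])
qed

lemma rho_pow_3: "rho ^^ 3 = id"
proof
  fix x :: 3
  show "(rho ^^ 3) x = id x"
    using exhaust_3[of x] by (auto simp: numeral_3_eq_3 simp del: One_nat_def)
qed

lemma rho_pow_mod: "rho ^^ r = rho ^^ (r mod 3)"
proof -
  have "rho ^^ r = rho ^^ (3 * (r div 3) + r mod 3)" by simp
  also have "\<dots> = (rho ^^ 3) ^^ (r div 3) \<circ> rho ^^ (r mod 3)"
    by (simp only: funpow_add funpow_mult mult.commute)
  finally show ?thesis by (simp add: rho_pow_3)
qed

lemma orbit_representative_cases:
  assumes "\<tau> permutes UNIV" "\<tau> (1::3) = 1" "r < 3"
  shows "(\<tau> \<circ> (rho ^^ r)) 1 = 1 \<longleftrightarrow> r = 0"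
    and "(\<tau> \<circ> (rho ^^ r)) 3 = 1 \<longleftrightarrow> r = 1"
    and "(\<tau> \<circ> (rho ^^ r)) 2 = 1 \<longleftrightarrow> r = 2"
proof -
  have *: "\<tau> x = 1 \<longleftrightarrow> x = 1" for x
    using assms(1,2) by (metis permutes_inverses(2))
  have r: "r = 0 \<or> r = 1 \<or> r = 2" using assms(3) by linarith
  show "(\<tau> \<circ> (rho ^^ r)) 1 = 1 \<longleftrightarrow> r = 0" "(\<tau> \<circ> (rho ^^ r)) 3 = 1 \<longleftrightarrow> r = 1"
    "(\<tau> \<circ> (rho ^^ r)) 2 = 1 \<longleftrightarrow> r = 2"
    using r distinct_3 by (auto simp: * numeral_2_eq_2)
qed

lemma orbital_phase_eq:
  assumes "\<tau> permutes UNIV" "\<tau> 1 = 1"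
  shows "orbital_phase (\<tau> \<circ> (rho ^^ r)) = r mod 3"
  unfolding orbital_phase_def
proof (rule the_equality)
  show "r mod 3 < 3 \<and> (\<exists>\<tau>'. \<tau>' permutes UNIV \<and> \<tau>' 1 = 1 \<and>
      \<tau> \<circ> (rho ^^ r) = \<tau>' \<circ> (rho ^^ (r mod 3)))"
    using assms rho_pow_mod[of r] by auto
next
  fix s
  assume "s < 3 \<and> (\<exists>\<tau>'. \<tau>' permutes UNIV \<and> \<tau>' 1 = 1 \<and> \<tau> \<circ> (rho ^^ r) = \<tau>' \<circ> (rho ^^ s))"
  then obtain \<tau>' where s: "s < 3" "\<tau>' permutes UNIV" "\<tau>' 1 = 1"
    and e: "\<tau> \<circ> (rho ^^ (r mod 3)) = \<tau>' \<circ> (rho ^^ s)"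
    using rho_pow_mod[of r] by auto
  have m: "r mod 3 < 3" by simp
  note a = orbit_representative_cases[OF assms m, unfolded e]
    and b = orbit_representative_cases[OF s(2,3,1)]
  have "s = 0 \<or> s = 1 \<or> s = 2" using s(1) by linarith
  then show "s = r mod 3" using a b by metis
qed

lemma orbital_phase_unique:
  assumes "\<And>\<tau> r. \<tau> permutes UNIV \<Longrightarrow> \<tau> 1 = 1 \<Longrightarrow> f (\<tau> \<circ> (rho ^^ r)) = r mod 3"
    and \<sigma>: "\<sigma> permutes UNIV"
  shows "f \<sigma> = orbital_phase \<sigma>"
proof -
  obtain x where x: "\<sigma> x = 1" using \<sigma> by (metis permutes_inverses(1))
  have "\<exists>n\<le>3. (rho ^^ n) 1 = x"
  proof -
    have "(rho ^^ 0) 1 = 1" "(rho ^^ 1) 1 = 2" "(rho ^^ 2) 1 = 3"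
      by (simp_all add: numeral_2_eq_2)
    moreover have "(0::nat) \<le> 3" "(1::nat) \<le> 3" "(2::nat) \<le> 3" by simp_all
    ultimately show ?thesis using exhaust_3[of x] by blast
  qed
  then obtain n where n: "n \<le> 3" "(rho ^^ n) 1 = x" by blast
  define \<tau> where "\<tau> = \<sigma> \<circ> (rho ^^ n)"
  have t: "\<tau> permutes UNIV" "\<tau> 1 = 1"
    unfolding \<tau>_def using \<sigma> n x rho_pow_permutes by (auto intro: permutes_compose)
  have "\<tau> \<circ> (rho ^^ (3 - n)) = \<sigma> \<circ> (rho ^^ (n + (3 - n)))"
    unfolding \<tau>_def by (simp only: funpow_add o_assoc)
  then have "\<sigma> = \<tau> \<circ> (rho ^^ (3 - n))" using n by (simp add: rho_pow_3)
  then show ?thesis using assms(1)[OF t] orbital_phase_eq[OF t] by metis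
qed

end

theory Submission
  imports Defs
begin

text \<open>
  The determinant is the single component \<open>G 0\<close> of \<open>D_phi\<close>, so it cannot see how the signed
  monomials are distributed over the phases. Permutation matrices show this in the barest form:
  the matrix of \<open>\<pi>\<close> has exactly one nonzero monomial, the one belonging to \<open>\<pi>\<close>, and so
  its \<open>k\<close>-th invariant is \<open>sign \<pi>\<close> twisted by \<open>omega\<close> to the power \<open>k\<close> times the phase of
  \<open>\<pi>\<close> (lemma \<open>G_perm_matrix\<close>). The permutations \<open>id\<close> and \<open>rho\<close> are both even, hence both
  matrices have determinant \<open>1\<close>; but their phases are \<open>0\<close> and \<open>1\<close>, hence \<open>G 1\<close> takes the
  values \<open>1\<close> and \<open>omega\<close>, which differ.
\<close>

definition perm_matrix :: "('n \<Rightarrow> 'n) \<Rightarrow> 'a::zero_neq_one^'n^'n" where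
  "perm_matrix \<pi> = (\<chi> i j. if j = \<pi> i then 1 else 0)"

lemma map_matrix_perm_matrix:
  "map_matrix complex_of_real (perm_matrix \<pi>) = perm_matrix \<pi>"
  by (simp add: perm_matrix_def map_matrix_def vec_eq_iff)

text \<open>The matrix of \<open>\<pi>\<close> arises from the identity matrix by permuting its rows.\<close>

lemma det_perm_matrix:
  fixes \<pi> :: "'n::finite \<Rightarrow> 'n"
  assumes "\<pi> permutes UNIV"
  shows "det (perm_matrix \<pi> :: 'a::comm_ring_1^'n^'n) = of_int (sign \<pi>)"
proof -
  have "(perm_matrix \<pi> :: 'a^'n^'n) = (\<chi> i. mat 1 $ \<pi> i)"
    by (auto simp: perm_matrix_def mat_def vec_eq_iff)
  then show ?thesis
    using det_permute_rows[OF assms, of "mat 1 :: 'a^'n^'n"] by simp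
qed

lemma signed_monomial_perm_matrix:
  "signed_monomial \<sigma> (perm_matrix \<pi>) = (if \<sigma> = \<pi> then of_int (sign \<pi>) else 0)"
proof (cases "\<sigma> = \<pi>")
  case True
  then show ?thesis by (simp add: signed_monomial_def perm_matrix_def)
next
  case False
  then obtain i where "\<sigma> i \<noteq> \<pi> i" by blast
  then have "(\<Prod>i\<in>UNIV. perm_matrix \<pi> $ i $ \<sigma> i) = (0::complex)"
    by (intro prod_zero) (auto simp: perm_matrix_def)
  with False show ?thesis by (simp add: signed_monomial_def)
qed

lemma Lambda_perm_matrix:
  assumes "\<pi> permutes UNIV"
  shows "Lambda r (perm_matrix \<pi>) = (if r = orbital_phase \<pi> then of_int (sign \<pi>) else 0)"
  using assms by (auto simp: Lambda_def signed_monomial_perm_matrix)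

lemma G_perm_matrix:
  assumes "\<pi> permutes UNIV" and "orbital_phase \<pi> < 3"
  shows "G k (perm_matrix \<pi>) = of_int (sign \<pi>) * omega ^ (k * orbital_phase \<pi>)"
proof -
  have "G k (perm_matrix \<pi>) =
      (\<Sum>r = 0..2. if r = orbital_phase \<pi> then of_int (sign \<pi>) * omega ^ (k * r) else 0)"
    unfolding G_def by (intro sum.cong refl) (simp add: Lambda_perm_matrix[OF assms(1)])
  then show ?thesis using assms(2) by simp
qed

text \<open>A permutation whose cube is the identity has a sign whose cube is \<open>1\<close>, so it is even.\<close>

lemma sign_rho: "sign rho = 1"
proof -
  have p: "permutation rho"
    using rho_permutes by (auto simp: permutation_permutes)
  have "rho \<circ> (rho \<circ> rho) = id"
    using rho_pow_3 by (simp add: numeral_3_eq_3)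
  then have "sign rho * (sign rho * sign rho) = 1"
    using p by (metis permutation_compose sign_compose sign_id)
  then show ?thesis by simp
qed

lemma orbital_phase_id: "orbital_phase id = 0"
  using orbital_phase_eq[of id 0] by simp

lemma orbital_phase_rho: "orbital_phase rho = 1"
  using orbital_phase_eq[of id 1] by simp

lemma omega_neq_1: "omega \<noteq> 1"
proof
  assume "omega = 1"
  then obtain n :: int where "2 * pi / 3 = of_int (2 * n) * pi"
    by (auto simp: omega_def exp_eq_1)
  then have "3 * real_of_int n = 1" by (simp add: field_simps)
  then have "3 * n = 1" by linarith
  then show False by presburger
qed

theorem proposition4p4:
  shows "\<exists>A B :: real^3^3. det A = det B \<and>
    D_phi (map_matrix complex_of_real A) \<noteq> D_phi (map_matrix complex_of_real B)"
proof (intro exI conjI)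
  show "det (perm_matrix id :: real^3^3) = det (perm_matrix rho :: real^3^3)"
    by (simp add: det_perm_matrix rho_permutes sign_rho)
  have "G 1 (perm_matrix id) = 1"
    by (simp add: G_perm_matrix orbital_phase_id)
  moreover have "G 1 (perm_matrix rho) = omega"
    by (simp add: G_perm_matrix rho_permutes orbital_phase_rho sign_rho)
  ultimately have "D_phi (perm_matrix id) $ 2 \<noteq> D_phi (perm_matrix rho) $ 2"
    using omega_neq_1 by (simp add: D_phi_def)
  then show "D_phi (map_matrix complex_of_real (perm_matrix id)) \<noteq>
      D_phi (map_matrix complex_of_real (perm_matrix rho))"
    by (auto simp: map_matrix_perm_matrix)
qed

end
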